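(* Let $n\geq 2$ be an integer. The following assertions hold: (i) If $n$ is even, $C_{1,1}=\mathrm{circ}(1,1,0,\ldots,0)$ (of order $n$), $v=(1,-1,1,-1,\ldots,1,-1)\in\mathbb{R}^n$ and $w\in\mathbb{R}^n$ is given by $w(k)=(-1)^{k+1}\left(n^{2}-(2k-1)n+2\right)$ for $k=1,\ldots,n$, then $C_{1,1}+vv^{t}=\mathrm{circ}(2,0,1,-1,\ldots,1,-1)$ is invertible and $$\left(C_{1,1}+vv^{t}\right)^{-1}=\frac{1}{2n^{2}}\mathrm{circ}(w).$$ (ii) If $C_{1,-1}=\mathrm{circ}(1,-1,0,\ldots,0)$ (of order $n$), then $C_{1,-1}+ee^{t}=\mathrm{circ}(2,0,1,\ldots,1)$ is invertible and $$\left(C_{1,-1}+ee^{t}\right)^{-1}=-\frac{1}{2n}\mathrm{circ}(1,3,5,\ldots,2n-1)+\frac{n^{2}+2}{2n^{2}}ee^{t}.$$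
   Context: For $c\in\mathbb{C}^n$, $\mathrm{circ}(c)$ is the $n\times n$ circulant matrix whose first row is $(c(1),\ldots,c(n))$ and each of whose subsequent rows is the cyclic right shift by one of the previous row; equivalently $\mathrm{circ}(c)=\sum_{k=0}^{n-1}c(k+1)\Pi^k$ with $\Pi=\mathrm{circ}(0,1,0,\ldots,0)$. Vectors are regarded as column vectors; $e$ is the vector in $\mathbb{R}^n$ with all components equal to $1$; $t$ denotes transpose. *)

theory Defs
  imports Complex_Main "Jordan_Normal_Form.Gauss_Jordan_Elimination"
begin

(* Vectors and matrices of Jordan_Normal_Form are indexed from 0, so the
   1-based component c(k), k = 1, ..., n, is c $ (k - 1). *)

definition right_shift :: "'a vec \<Rightarrow> 'a vec" where
  "right_shift c = vec (dim_vec c)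
     (\<lambda>j. if j = 0 then c $ (dim_vec c - 1) else c $ (j - 1))"

definition circ :: "'a vec \<Rightarrow> 'a mat" where
  "circ c = mat\<^sub>r (dim_vec c) (dim_vec c) (\<lambda>i. (right_shift ^^ i) c)"

lemma dim_right_shift_funpow [simp]: "dim_vec ((right_shift ^^ i) c) = dim_vec c"
  by (induction i) (simp_all add: right_shift_def)

lemma circ_carrier [simp]: "circ c \<in> carrier_mat (dim_vec c) (dim_vec c)"
  unfolding circ_def by (rule carrier_matI) simp_all

lemma right_shift_funpow_index:
  assumes "i \<le> dim_vec c" "j < dim_vec c"
  shows "(right_shift ^^ i) c $ j = c $ ((j + dim_vec c - i) mod dim_vec c)"
  using assms
proof (induction i arbitrary: j)
  case (Suc i)
  show ?case
  proof (cases "j = 0")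
    case True
    have "(right_shift ^^ Suc i) c $ j = (right_shift ^^ i) c $ (dim_vec c - 1)"
      using Suc.prems True by (simp add: right_shift_def)
    also have "\<dots> = c $ ((dim_vec c - 1 + dim_vec c - i) mod dim_vec c)"
      using Suc.prems by (intro Suc.IH) auto
    also have "dim_vec c - 1 + dim_vec c - i = (j + dim_vec c - Suc i) + dim_vec c"
      using Suc.prems True by auto
    finally show ?thesis by simp
  next
    case False
    have "(right_shift ^^ Suc i) c $ j = (right_shift ^^ i) c $ (j - 1)"
      using Suc.prems False by (simp add: right_shift_def)
    also have "\<dots> = c $ ((j - 1 + dim_vec c - i) mod dim_vec c)"
      using Suc.prems by (intro Suc.IH) auto
    also have "j - 1 + dim_vec c - i = j + dim_vec c - Suc i"
      using Suc.prems False by auto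
    finally show ?thesis .
  qed
qed simp

lemma circ_index:
  assumes "i < dim_vec c" "j < dim_vec c"
  shows "circ c $$ (i, j) = c $ ((j + dim_vec c - i) mod dim_vec c)"
  using assms by (simp add: circ_def right_shift_funpow_index)

(* A vector regarded as a column, i.e. as an n x 1 matrix. *)
definition column :: "'a vec \<Rightarrow> 'a mat" where
  "column x = mat_of_cols (dim_vec x) [x]"

end

theory Submission
  imports Defs "Jordan_Normal_Form.Determinant"
begin

text \<open>
  Both assertions are instances, for \<open>s = -1\<close> and \<open>s = 1\<close>, of one identity about a sign \<open>s\<close> with
  \<open>s ^ n = 1\<close>: write \<open>C = circ (1, -s, 0, \<dots>, 0)\<close> and \<open>u = (1, s, s\<^sup>2, \<dots>)\<close>, and let the candidate inverse
  be the circulant matrix \<open>B\<close> of \<open>s ^ d * b d\<close>, where \<open>b d\<close> is affine in \<open>d\<close> with slope \<open>- 1 / n\<close>.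
  Up to signs, multiplying by \<open>C\<close> takes cyclic differences of \<open>b\<close>, which are \<open>- 1 / n\<close> except at the wrap-around, where
  the difference is \<open>1 - 1 / n\<close>. Since the \<open>b d\<close> sum to \<open>1 / n\<close>, the product of \<open>u u\<^sup>t\<close> with \<open>B\<close> adds
  exactly the missing \<open>1 / n\<close>.
\<close>

text \<open>For square matrices over a field a right inverse is also a left inverse, so
  \<open>A\<close> is a unit of the matrix ring and the result \<open>None\<close> is excluded. Any
  result \<open>Some D\<close> has \<open>D = D * (A * B) = (D * A) * B = B\<close>.\<close>

lemma mat_inverse_eqI:
  fixes A :: "'a :: field mat"
  assumes A: "A \<in> carrier_mat n n" and B: "B \<in> carrier_mat n n" and AB: "A * B = 1\<^sub>m n"
  shows "invertible_mat A" "mat_inverse A = Some B"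
proof -
  have BA: "B * A = 1\<^sub>m n"
    by (rule mat_mult_left_right_inverse[OF A B AB])
  show "invertible_mat A"
    using A B AB BA unfolding invertible_mat_def inverts_mat_def by auto
  show "mat_inverse A = Some B"
  proof (cases "mat_inverse A")
    case None
    have "A \<in> Units (ring_mat TYPE('a) n ())"
      using A B AB BA unfolding Units_def ring_mat_def by auto
    with mat_inverse(1)[OF A None, of "()"] show ?thesis by blast
  next
    case (Some D)
    from mat_inverse(2)[OF A Some] have D: "D * A = 1\<^sub>m n" "D \<in> carrier_mat n n" by auto
    have "D = D * (A * B)" using D AB by simp
    also have "\<dots> = (D * A) * B" by (rule assoc_mult_mat[OF D(2) A B, symmetric])
    also have "\<dots> = B" using D B by simp
    finally show ?thesis using Some by simp
  qed
qed

lemma circ_dim [simp]: "dim_row (circ c) = dim_vec c" "dim_col (circ c) = dim_vec c"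
  using carrier_matD[OF circ_carrier[of c]] by auto

lemma column_dim [simp]: "dim_row (column x) = dim_vec x" "dim_col (column x) = 1"
  by (simp_all add: column_def)

lemma scalar_prod_row_column [simp]:
  assumes "i < dim_vec x" "j < dim_vec x"
  shows "row (column x) i \<bullet> row (column x) j = x $ i * (x $ j :: 'a :: comm_semiring_1)"
  using assms by (simp add: column_def scalar_prod_def mat_of_cols_index)

text \<open>Removes \<open>mod\<close> from the index occurring in \<open>circ_index\<close>, so
  that questions about cyclic positions become linear arithmetic in two cases.\<close>

lemma mod_cyclic_diff:
  fixes i k n :: nat
  assumes "i < n" "k < n"
  shows "(k + n - i) mod n = (if i \<le> k then k - i else k + n - i)"
proof (cases "i \<le> k")
  case True
  then have "k + n - i = (k - i) + n" by simp
  then have "(k + n - i) mod n = (k - i) mod n" by (simp only: mod_add_self2)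
  with True assms show ?thesis by simp
qed (use assms in simp)

text \<open>The map sending \<open>k\<close> to \<open>j - k\<close> modulo \<open>n\<close> is an
  involution on the residues, hence its own inverse in the reindexing. It says that a column of a
  circulant matrix runs through every entry exactly once.\<close>

lemma sum_cyclic_reflect:
  fixes g :: "nat \<Rightarrow> 'a :: comm_monoid_add"
  assumes "j < n"
  shows "(\<Sum>k<n. g ((j + n - k) mod n)) = (\<Sum>d<n. g d)"
proof (rule sum.reindex_bij_witness[where i = "\<lambda>d. (j + n - d) mod n" and j = "\<lambda>k. (j + n - k) mod n"])
  have *: "(j + n - (j + n - k) mod n) mod n = k" if "k < n" for k
    using that assms by (cases "k \<le> j") (simp_all add: mod_cyclic_diff)
  show "(j + n - (j + n - k) mod n) mod n = k" if "k \<in> {..<n}" for k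
    using * that by simp
  show "(j + n - (j + n - k) mod n) mod n = k" if "k \<in> {..<n}" for k
    using * that by simp
qed (use assms in auto)

text \<open>Exponents of \<open>s\<close> count only modulo \<open>n\<close> because
  \<open>s ^ n = 1\<close>, and \<open>s ^ i\<close> is its own inverse because its square is 1.
  This is why the rank-one matrix of the sign vector is itself circulant.\<close>

lemma sign_power_cyclic_diff:
  fixes s :: "'a :: comm_ring_1"
  assumes "s\<^sup>2 = 1" "s ^ n = 1" "i < n"
  shows "s ^ ((k + n - i) mod n) = s ^ i * s ^ k"
proof -
  have "s ^ m = s ^ (m mod n)" for m
    using assms(2) by (metis mod_mult_div_eq mult.right_neutral power_add power_mult power_one)
  then have "s ^ ((k + n - i) mod n) = s ^ (k + n - i)" by metis
  \<comment> \<open>Inserting \<open>s ^ i * s ^ i = 1\<close> lets one factor cancel the truncated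
    subtraction in the exponent.\<close>
  also have "\<dots> = s ^ i * s ^ i * s ^ (k + n - i)"
    using assms(1) by (simp add: power_mult_distrib[symmetric] power2_eq_square)
  also have "\<dots> = s ^ i * s ^ (i + (k + n - i))"
    by (simp add: power_add mult.assoc)
  also have "i + (k + n - i) = k + n" using assms(3) by simp
  finally show ?thesis using assms(2) by (simp add: power_add)
qed

context
  fixes n :: nat and s :: real
  assumes n: "n \<ge> 2" and s: "s\<^sup>2 = 1" "s ^ n = 1"
begin

text \<open>The rank-one term is the circulant matrix of the powers of \<open>s\<close>; the other
  summand alters only positions 0 and 1, giving \<open>1 + 1 = 2\<close> and
  \<open>s - s = 0\<close>.\<close>

lemma circ_plus_rank_one:
  "circ (vec n (\<lambda>i. if i = 0 then 1 else if i = 1 then - s else 0))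
     + column (vec n (\<lambda>i. s ^ i)) * (column (vec n (\<lambda>i. s ^ i)))\<^sup>T
   = circ (vec n (\<lambda>i. if i = 0 then 2 else if i = 1 then 0 else s ^ i))"
  (is "circ ?c + column ?u * _ = circ ?a")
proof (rule eq_matI)
  fix i k assume "i < dim_row (circ ?a)" "k < dim_col (circ ?a)"
  then have ik: "i < n" "k < n" by auto
  then have u: "(column ?u * (column ?u)\<^sup>T) $$ (i, k) = s ^ ((k + n - i) mod n)"
    using sign_power_cyclic_diff[OF s ik(1)] by simp
  have "(circ ?c + column ?u * (column ?u)\<^sup>T) $$ (i, k)
      = circ ?c $$ (i, k) + (column ?u * (column ?u)\<^sup>T) $$ (i, k)"
    using ik by (intro index_add_mat) auto
  then show "(circ ?c + column ?u * (column ?u)\<^sup>T) $$ (i, k) = circ ?a $$ (i, k)"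
    unfolding u using ik by (simp add: circ_index)
qed auto

lemma circ_plus_rank_one_inverse:
  "(circ (vec n (\<lambda>i. if i = 0 then 1 else if i = 1 then - s else 0))
     + column (vec n (\<lambda>i. s ^ i)) * (column (vec n (\<lambda>i. s ^ i)))\<^sup>T)
   * circ (vec n (\<lambda>i. s ^ i * (((real n)\<^sup>2 - (2 * real i + 1) * real n + 2) / (2 * (real n)\<^sup>2))))
   = 1\<^sub>m n"
  (is "(circ ?c + ?U) * circ ?w = _")
proof (rule eq_matI)
  define b where "b d = ((real n)\<^sup>2 - (2 * real d + 1) * real n + 2) / (2 * (real n)\<^sup>2)" for d
  have sum_b: "(\<Sum>d<n. b d) = 1 / n"
  proof -
    \<comment> \<open>The upper limit is freed from the \<open>n\<close> in the summand to allow
      induction. At \<open>m = n\<close> the cubic terms cancel and \<open>2 * n\<close> remains, to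
      be divided by \<open>2 * n^2\<close>.\<close>
    have "(\<Sum>d<m. (real n)\<^sup>2 - (2 * real d + 1) * real n + 2)
        = m * (real n)\<^sup>2 - (real m)\<^sup>2 * n + 2 * m" for m
      by (induction m) (simp_all add: algebra_simps power2_eq_square)
    from this[of n] show ?thesis
      unfolding b_def sum_divide_distrib[symmetric] using n by (simp add: power2_eq_square)
  qed
  fix i j assume "i < dim_row (1\<^sub>m n :: real mat)" "j < dim_col (1\<^sub>m n :: real mat)"
  then have ij: "i < n" "j < n" by auto
  \<comment> \<open>The cyclic successor of \<open>i\<close>: the column in which row
    \<open>i\<close> of \<open>circ ?c\<close> has its entry \<open>- s\<close>.\<close>
  define i' where "i' = (if Suc i = n then 0 else Suc i)"
  have i': "i' < n" "i' \<noteq> i" using ij n by (auto simp: i'_def mod_cyclic_diff)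
  have B: "circ ?w $$ (k, j) = s ^ k * s ^ j * b ((j + n - k) mod n)" if "k < n" for k
    using that ij n sign_power_cyclic_diff[OF s that, of j] by (simp add: circ_index b_def)
  have A: "(circ ?c + ?U) $$ (i, k)
      = (if k = i then 1 else 0) + (if k = i' then - s else 0) + s ^ i * s ^ k" if "k < n" for k
  proof -
    have "(k + n - i) mod n = 0 \<longleftrightarrow> k = i" "(k + n - i) mod n = 1 \<longleftrightarrow> k = i'"
      using that ij n by (auto simp: i'_def mod_cyclic_diff)
    then show ?thesis
      using that ij i'
      by (auto simp: circ_index)
  qed
  have ss: "s ^ k * s ^ k = 1" for k
    using s(1) by (simp add: power_mult_distrib[symmetric] power2_eq_square)
  have "((circ ?c + ?U) * circ ?w) $$ (i, j) = (\<Sum>k<n. (circ ?c + ?U) $$ (i, k) * circ ?w $$ (k, j))"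
    using ij by (auto simp: scalar_prod_def lessThan_atLeast0 intro!: sum.cong)
  \<comment> \<open>Row \<open>i\<close> of \<open>circ ?c\<close> has just two nonzero entries, so
    its share of the product is two single terms; the rank-one share remains a full sum.\<close>
  also have "\<dots> = (\<Sum>k<n. (if k = i then circ ?w $$ (k, j) else 0)
      + (if k = i' then - s * circ ?w $$ (k, j) else 0) + s ^ i * s ^ k * circ ?w $$ (k, j))"
    by (intro sum.cong) (auto simp: A algebra_simps)
  also have "\<dots> = circ ?w $$ (i, j) - s * circ ?w $$ (i', j)
      + (\<Sum>k<n. s ^ i * s ^ k * circ ?w $$ (k, j))"
    using ij i' by (simp add: sum.distrib)
  also have "(\<Sum>k<n. s ^ i * s ^ k * circ ?w $$ (k, j))
      = (\<Sum>k<n. s ^ i * s ^ j * b ((j + n - k) mod n))"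
  proof (intro sum.cong refl)
    fix k assume "k \<in> {..<n}"
    then have k: "k < n" by simp
    \<comment> \<open>The sign \<open>s ^ k\<close> occurs once in the rank-one factor and once in
      the entry of \<open>circ ?w\<close>; their product is 1, which leaves an unsigned sum of
      \<open>b\<close>.\<close>
    have "s ^ i * s ^ k * circ ?w $$ (k, j)
        = s ^ i * s ^ j * b ((j + n - k) mod n) * (s ^ k * s ^ k)"
      unfolding B[OF k] by (simp only: mult_ac)
    then show "s ^ i * s ^ k * circ ?w $$ (k, j) = s ^ i * s ^ j * b ((j + n - k) mod n)"
      by (simp only: ss mult_1_right)
  qed
  also have "\<dots> = s ^ i * s ^ j * (1 / n)"
    using sum_cyclic_reflect[OF ij(2), of b] by (simp add: sum_distrib_left[symmetric] sum_b)
  also have "s * circ ?w $$ (i', j) = s ^ i * s ^ j * b ((j + n - i') mod n)"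
  proof -
    \<comment> \<open>At the wrap-around \<open>i' = 0\<close> and \<open>Suc i = n\<close>, so the
      equation is \<open>s ^ n = 1\<close>.\<close>
    have "s ^ i' = s ^ Suc i" using ij s(2) by (auto simp: i'_def mod_cyclic_diff)
    then have "s * s ^ i' = s ^ i" using ss[of 1] by (simp add: mult.assoc[symmetric])
    then show ?thesis using B[OF i'(1)] by (simp add: mult.assoc[symmetric])
  qed
  also have "circ ?w $$ (i, j) = s ^ i * s ^ j * b ((j + n - i) mod n)"
    by (rule B[OF ij(1)])
  also have "s ^ i * s ^ j * b ((j + n - i) mod n) - s ^ i * s ^ j * b ((j + n - i') mod n)
        + s ^ i * s ^ j * (1 / n)
      = s ^ i * s ^ j * (b ((j + n - i) mod n) - b ((j + n - i') mod n) + 1 / n)"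
    by (simp add: algebra_simps)
  \<comment> \<open>Passing from \<open>i\<close> to \<open>i'\<close> lowers the cyclic index by
    one. On the diagonal it wraps from 0 to \<open>n - 1\<close>, where
    \<open>b 0 - b (n - 1) = 1 - 1 / n\<close>; elsewhere the difference is the slope
    \<open>- 1 / n\<close>.\<close>
  also have "\<dots> = (if i = j then 1 else 0)"
  proof (cases "i = j")
    case True
    then have "(j + n - i) mod n = 0" "(j + n - i') mod n = n - 1"
      using ij n by (auto simp: i'_def mod_cyclic_diff)
    moreover have "b 0 - b (n - 1) + 1 / n = 1"
      using n by (simp add: b_def field_simps power2_eq_square of_nat_diff)
    ultimately show ?thesis using True ss by simp
  next
    case False
    then have "(j + n - i) mod n = Suc ((j + n - i') mod n)"
      using ij n by (auto simp: i'_def mod_cyclic_diff)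
    moreover have "b (Suc d) - b d + 1 / n = 0" for d
      using n by (simp add: b_def field_simps power2_eq_square)
    ultimately show ?thesis using False by simp
  qed
  finally show "((circ ?c + ?U) * circ ?w) $$ (i, j) = 1\<^sub>m n $$ (i, j)"
    using ij by simp
qed auto

lemma circ_plus_rank_one_mat_inverse:
  defines "A \<equiv> circ (vec n (\<lambda>i. if i = 0 then 1 else if i = 1 then - s else 0))
     + column (vec n (\<lambda>i. s ^ i)) * (column (vec n (\<lambda>i. s ^ i)))\<^sup>T"
  shows "invertible_mat A"
    and "mat_inverse A = Some (circ (vec n
      (\<lambda>i. s ^ i * (((real n)\<^sup>2 - (2 * real i + 1) * real n + 2) / (2 * (real n)\<^sup>2)))))"
      (is "_ = Some (circ ?w)")
proof -
  have "A \<in> carrier_mat n n" "circ ?w \<in> carrier_mat n n"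
    by (auto simp: A_def intro!: carrier_matI)
  from mat_inverse_eqI[OF this circ_plus_rank_one_inverse[folded A_def]]
  show "invertible_mat A" "mat_inverse A = Some (circ ?w)" by auto
qed

end

theorem lemma4p2:
  fixes n :: nat
  assumes "n \<ge> 2"
  shows
    "(even n \<longrightarrow>
       (let C = circ (vec n (\<lambda>i. if i = 0 \<or> i = 1 then 1 else 0)) :: real mat;
            v = vec n (\<lambda>i. (-1) ^ i) :: real vec;
            w = vec n (\<lambda>i. let k = i + 1 in
                  (-1) ^ (k + 1) * ((real n)\<^sup>2 - (2 * real k - 1) * real n + 2)) :: real vec;
            A = C + column v * (column v)\<^sup>T
        in A = circ (vec n (\<lambda>i. if i = 0 then 2 else if i = 1 then 0 else (-1) ^ i))
         \<and> invertible_mat A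
         \<and> mat_inverse A = Some ((1 / (2 * (real n)\<^sup>2)) \<cdot>\<^sub>m circ w)))
     \<and>
     (let C = circ (vec n (\<lambda>i. if i = 0 then 1 else if i = 1 then -1 else 0)) :: real mat;
          e = vec n (\<lambda>i. 1) :: real vec;
          A = C + column e * (column e)\<^sup>T
      in A = circ (vec n (\<lambda>i. if i = 0 then 2 else if i = 1 then 0 else 1))
       \<and> invertible_mat A
       \<and> mat_inverse A = Some
           ((- 1 / (2 * real n)) \<cdot>\<^sub>m circ (vec n (\<lambda>i. 2 * real i + 1))
            + (((real n)\<^sup>2 + 2) / (2 * (real n)\<^sup>2)) \<cdot>\<^sub>m (column e * (column e)\<^sup>T)))"
proof (intro conjI impI, goal_cases)
  case 1
  define c v a w :: "real vec" where
    "c = vec n (\<lambda>i. if i = 0 \<or> i = 1 then 1 else 0)" and "v = vec n (\<lambda>i. (-1) ^ i)" and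
    "a = vec n (\<lambda>i. if i = 0 then 2 else if i = 1 then 0 else (-1) ^ i)" and
    "w = vec n (\<lambda>i. let k = i + 1 in
                  (-1) ^ (k + 1) * ((real n)\<^sup>2 - (2 * real k - 1) * real n + 2))"
  note defs = this
  let ?A = "circ c + column v * (column v)\<^sup>T"
  have s: "(-1 :: real)\<^sup>2 = 1" "(-1 :: real) ^ n = 1" using 1 by auto
  \<comment> \<open>Writing the entry 1 as \<open>- (-1)\<close> makes \<open>c\<close> match the
    general vector at \<open>s = -1\<close>.\<close>
  have c: "c = vec n (\<lambda>i. if i = 0 then 1 else if i = 1 then - (-1) else 0)"
    by (auto simp: c_def)
  have "?A = circ a"
    unfolding c v_def a_def by (rule circ_plus_rank_one[OF assms s])
  moreover have "invertible_mat ?A"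
    unfolding c v_def by (rule circ_plus_rank_one_mat_inverse[OF assms s])
  \<comment> \<open>With \<open>k = i + 1\<close> the sign \<open>(-1) ^ (k + 1)\<close> is
    \<open>(-1) ^ i\<close> and \<open>2 * k - 1\<close> is \<open>2 * i + 1\<close>; the common
    denominator becomes the scalar factor.\<close>
  moreover have "circ (vec n
      (\<lambda>i. (-1) ^ i * (((real n)\<^sup>2 - (2 * real i + 1) * real n + 2) / (2 * (real n)\<^sup>2))))
      = (1 / (2 * (real n)\<^sup>2)) \<cdot>\<^sub>m circ w" (is "circ ?w = _")
    by (intro eq_matI) (auto simp: circ_index w_def)
  then have "mat_inverse ?A = Some ((1 / (2 * (real n)\<^sup>2)) \<cdot>\<^sub>m circ w)"
    unfolding c v_def using circ_plus_rank_one_mat_inverse(2)[OF assms s] by simp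
  ultimately show ?case
    unfolding defs Let_def by blast
next
  case 2
  define c e a :: "real vec" where
    "c = vec n (\<lambda>i. if i = 0 then 1 else if i = 1 then -1 else 0)" and "e = vec n (\<lambda>i. 1)" and
    "a = vec n (\<lambda>i. if i = 0 then 2 else if i = 1 then 0 else 1)"
  note defs = this
  let ?A = "circ c + column e * (column e)\<^sup>T"
  let ?B = "(- 1 / (2 * real n)) \<cdot>\<^sub>m circ (vec n (\<lambda>i. 2 * real i + 1))
            + (((real n)\<^sup>2 + 2) / (2 * (real n)\<^sup>2)) \<cdot>\<^sub>m (column e * (column e)\<^sup>T)"
  have s: "(1 :: real)\<^sup>2 = 1" "(1 :: real) ^ n = 1" by auto
  have "?A = circ a"
    using circ_plus_rank_one[OF assms s] by (simp add: defs cong: if_cong)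
  moreover have "invertible_mat ?A"
    using circ_plus_rank_one_mat_inverse(1)[OF assms s] by (simp add: defs)
  \<comment> \<open>At \<open>s = 1\<close> the affine entries split: the part linear in
    \<open>2 * i + 1\<close> has coefficient \<open>- 1 / (2 * n)\<close>, and the constant part is
    a multiple of the all-ones matrix.\<close>
  moreover have "circ (vec n
      (\<lambda>i. ((real n)\<^sup>2 - (2 * real i + 1) * real n + 2) / (2 * (real n)\<^sup>2))) = ?B" (is "circ ?w = _")
  proof (rule eq_matI)
    fix i j assume "i < dim_row ?B" "j < dim_col ?B"
    then have "i < n" "j < n" by (auto simp: e_def)
    then show "circ ?w $$ (i, j) = ?B $$ (i, j)"
      using assms by (auto simp: circ_index e_def field_simps power2_eq_square)
  qed (auto simp: e_def)
  then have "mat_inverse ?A = Some ?B"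
    using circ_plus_rank_one_mat_inverse(2)[OF assms s] by (simp add: defs)
  ultimately show ?case
    unfolding defs Let_def by blast
qed

end
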